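(* Let $b>0$, $0<y<1$, and $\mu\in\mathbb{C}$ with $\mathrm{Re}(\mu)>0$. Then the $\mu$th lower incomplete Riemann--Liouville fractional integral defines a bounded (linear) operator $${}^{RL}_{0}D^{-\mu}[\,\cdot\,;y]:L^{\infty}[0,yb]\to L^{\infty}[0,b],$$ and the $\mu$th upper incomplete Riemann--Liouville fractional integral defines a bounded (linear) operator $${}^{RL}_{0}D^{-\mu}\{\,\cdot\,;y\}:L^{\infty}[0,b]\to L^{\infty}[0,b].$$
   Context: For $b>0$, $0<y<1$, $\mathrm{Re}(\mu)>0$, the $\mu$th lower and upper incomplete Riemann--Liouville fractional integrals of a complex-valued function $f$ are the functions of $x\in[0,b]$ given respectively by $${}^{RL}_{0}D_x^{-\mu}[f(x);y]=\frac{1}{\Gamma(\mu)}\int_0^{yx}(x-t)^{\mu-1}f(t)\,\mathrm{d}t,\qquad {}^{RL}_{0}D_x^{-\mu}\{f(x);y\}=\frac{1}{\Gamma(\mu)}\int_{yx}^{x}(x-t)^{\mu-1}f(t)\,\mathrm{d}t .$$ The lower one depends only on the values of $f$ on $[0,yb]$. $L^{\infty}$ denotes the usual Lebesgue space of essentially bounded complex-valued functions. *)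

theory Defs
  imports "HOL-Analysis.Analysis" "HOL-Probability.Essential_Supremum"
begin

text \<open>
  The space \<open>L\<^sup>\<infinity>\<close> over a measure space is represented by functions rather than by equivalence
  classes modulo equality almost everywhere.
\<close>

definition Linf_norm :: "'a measure \<Rightarrow> ('a \<Rightarrow> complex) \<Rightarrow> real" where
  "Linf_norm M f = real_of_ereal (esssup M (\<lambda>x. ereal (norm (f x))))"

definition Linf :: "'a measure \<Rightarrow> ('a \<Rightarrow> complex) set" where
  "Linf M = {f. f \<in> borel_measurable M \<and> esssup M (\<lambda>x. ereal (norm (f x))) < \<infinity>}"

text \<open>
  A map on functions that induces a bounded complex-linear operator between the quotient spaces.
  The second condition says that the induced map on equivalence classes is well defined.
\<close>

definition Linf_bounded_operator ::
  "'a measure \<Rightarrow> 'b measure \<Rightarrow> (('a \<Rightarrow> complex) \<Rightarrow> 'b \<Rightarrow> complex) \<Rightarrow> bool" where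
  "Linf_bounded_operator M N T \<longleftrightarrow>
     (\<forall>f\<in>Linf M. T f \<in> Linf N) \<and>
     (\<forall>f\<in>Linf M. \<forall>g\<in>Linf M. (AE x in M. f x = g x) \<longrightarrow> (AE x in N. T f x = T g x)) \<and>
     (\<forall>f\<in>Linf M. \<forall>g\<in>Linf M. AE x in N. T (\<lambda>t. f t + g t) x = T f x + T g x) \<and>
     (\<forall>c. \<forall>f\<in>Linf M. AE x in N. T (\<lambda>t. c * f t) x = c * T f x) \<and>
     (\<exists>C\<ge>0. \<forall>f\<in>Linf M. Linf_norm N (T f) \<le> C * Linf_norm M f)"

text \<open>
  The kernel uses the principal branch of the complex power with base \<open>x - t \<ge> 0\<close>.  At \<open>t = x\<close> it has
  the value 0, which does not affect the integrals.
\<close>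

definition RL_kernel :: "complex \<Rightarrow> real \<Rightarrow> real \<Rightarrow> complex" where
  "RL_kernel \<mu> x t = of_real (x - t) powr (\<mu> - 1)"

definition RL_lower :: "complex \<Rightarrow> real \<Rightarrow> (real \<Rightarrow> complex) \<Rightarrow> real \<Rightarrow> complex" where
  "RL_lower \<mu> y f x =
     1 / Gamma \<mu> * (LINT t:{0..y * x}|lebesgue. RL_kernel \<mu> x t * f t)"

definition RL_upper :: "complex \<Rightarrow> real \<Rightarrow> (real \<Rightarrow> complex) \<Rightarrow> real \<Rightarrow> complex" where
  "RL_upper \<mu> y f x =
     1 / Gamma \<mu> * (LINT t:{y * x..x}|lebesgue. RL_kernel \<mu> x t * f t)"

end

theory Submission
  imports Defs
begin

text \<open>
  Both operators integrate \<open>(x - t) powr (\<mu> - 1) * f t\<close> over a window \<open>{a * x..c * x}\<close> with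
  \<open>0 \<le> a\<close> and \<open>0 < c \<le> 1\<close>: the lower one has \<open>(a, c) = (0, y)\<close>, the upper one \<open>(a, c) = (y, 1)\<close>.
  For \<open>0 \<le> x \<le> b\<close> the window lies in \<open>{0..x}\<close> and in \<open>{0..c * b}\<close>, so it is enough to study
  \<open>RL_window\<close> as a map from the functions on \<open>{0..c * b}\<close> to the functions on \<open>{0..b}\<close>.

  The bound is the elementary one.  The kernel has modulus \<open>(x - t) powr (Re \<mu> - 1)\<close>, and
  \<open>Re \<mu> > 0\<close> makes the singularity at \<open>t = x\<close> integrable: the modulus has integral
  \<open>x powr Re \<mu> / Re \<mu> \<le> b powr Re \<mu> / Re \<mu>\<close> over \<open>{0..x}\<close>
  (\<open>norm_RL_kernel_integral\<close>).  Hence the integrand is integrable for every \<open>x\<close>, and the operator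
  norm is at most \<open>b powr Re \<mu> / (Re \<mu> * norm (Gamma \<mu>))\<close>.

  The point that needs more care is that the image is a measurable function of \<open>x\<close>
  (\<open>RL_window_measurable\<close>).  Changing \<open>f\<close> on a null set alters no value of the image
  (\<open>RL_window_cong_AE\<close>), so \<open>f\<close> may be taken Borel measurable.  The integrand is then jointly Borel
  measurable in \<open>(x, t)\<close>, and an integral over \<open>t\<close> of such a function is measurable in \<open>x\<close>.
\<close>

section \<open>Essentially bounded functions\<close>

text \<open>
  On a null space the essential supremum is \<open>-\<infinity>\<close>.  Otherwise, for an element of \<open>Linf M\<close>, it is a
  nonnegative real number, and \<open>Linf_norm\<close> loses nothing by its conversion from the extended
  reals.
\<close>

lemma Linf_AE_bound:
  assumes f: "f \<in> Linf M" and M: "emeasure M (space M) \<noteq> 0"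
  shows "0 \<le> Linf_norm M f" and "AE x in M. norm (f x) \<le> Linf_norm M f"
proof -
  let ?e = "esssup M (\<lambda>x. ereal (norm (f x)))"
  have meas[measurable]: "f \<in> borel_measurable M" and fin: "?e < \<infinity>"
    using f by (auto simp: Linf_def)
  have "esssup M (\<lambda>x. 0::ereal) \<le> ?e"
    by (intro esssup_mono) auto
  then have nonneg: "0 \<le> ?e"
    by (simp add: esssup_const[OF M])
  then have eq: "?e = ereal (Linf_norm M f)"
    using fin unfolding Linf_norm_def by (cases ?e) auto
  show "0 \<le> Linf_norm M f"
    using nonneg eq by simp
  show "AE x in M. norm (f x) \<le> Linf_norm M f"
    using esssup_AE[of "\<lambda>x. ereal (norm (f x))" M] by (simp add: eq)
qed

lemma Linf_I:
  assumes meas[measurable]: "f \<in> borel_measurable M"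
    and bound: "AE x in M. norm (f x) \<le> B" and M: "emeasure M (space M) \<noteq> 0"
  shows "f \<in> Linf M" and "Linf_norm M f \<le> B"
proof -
  have le: "esssup M (\<lambda>x. ereal (norm (f x))) \<le> ereal B"
    by (rule esssup_I) (use bound in auto)
  then have "esssup M (\<lambda>x. ereal (norm (f x))) < \<infinity>"
    by (rule le_less_trans) simp
  then show f: "f \<in> Linf M"
    by (simp add: Linf_def)
  have "esssup M (\<lambda>x. ereal (norm (f x))) = ereal (Linf_norm M f)"
  proof -
    have "esssup M (\<lambda>x. 0::ereal) \<le> esssup M (\<lambda>x. ereal (norm (f x)))"
      by (intro esssup_mono) auto
    with le show ?thesis
      unfolding Linf_norm_def
      by (cases "esssup M (\<lambda>x. ereal (norm (f x)))") (auto simp: esssup_const[OF M])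
  qed
  with le show "Linf_norm M f \<le> B" by simp
qed

lemma emeasure_lebesgue_on_interval_nonzero:
  assumes "(0::real) < d"
  shows "emeasure (lebesgue_on {0..d}) (space (lebesgue_on {0..d})) \<noteq> 0"
  using assms by (simp add: emeasure_restrict_space)

lemma lebesgue_measurable_ex_borel:
  fixes f :: "'a::euclidean_space \<Rightarrow> complex"
  assumes "f \<in> borel_measurable lebesgue"
  obtains g where "g \<in> borel_measurable borel" "AE t in lebesgue. f t = g t"
proof -
  have "(\<lambda>t. Re (f t)) \<in> borel_measurable (completion lborel)"
    and "(\<lambda>t. Im (f t)) \<in> borel_measurable (completion lborel)"
    using assms by simp_all
  from this[THEN completion_ex_borel_measurable_real]
  obtain u v where u: "u \<in> borel_measurable lborel" "AE t in lborel. Re (f t) = u t"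
    and v: "v \<in> borel_measurable lborel" "AE t in lborel. Im (f t) = v t"
    by blast
  show thesis
  proof
    show "(\<lambda>t. Complex (u t) (v t)) \<in> borel_measurable borel"
      using u(1) v(1) by (simp add: Complex_eq)
    show "AE t in lebesgue. f t = Complex (u t) (v t)"
      using AE_completion[OF u(2)] AE_completion[OF v(2)]
      by eventually_elim (simp add: complex_eq_iff)
  qed
qed

section \<open>The kernel\<close>

lemma norm_RL_kernel: "t \<le> x \<Longrightarrow> norm (RL_kernel \<mu> x t) = (x - t) powr (Re \<mu> - 1)"
  unfolding RL_kernel_def by (subst norm_powr_real_powr) auto

lemma RL_kernel_left:
  "t \<le> x \<Longrightarrow>
    RL_kernel \<mu> x t = (if t < x then exp ((\<mu> - 1) * of_real (ln (x - t))) else 0)"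
  using Ln_of_real[of "x - t"] by (auto simp: RL_kernel_def powr_def)

text \<open>
  Only the half-plane \<open>t \<le> x\<close> matters for the integrals.  Cutting the kernel off there reduces
  the principal branch of the power to the real logarithm, whose measurability is immediate.
\<close>

lemma RL_kernel_left_measurable:
  "(\<lambda>(x, t). if t \<le> x then RL_kernel \<mu> x t else 0) \<in> borel_measurable (borel \<Otimes>\<^sub>M borel)"
proof -
  have "(\<lambda>(x, t). if t \<le> x then RL_kernel \<mu> x t else 0) =
      (\<lambda>(x, t). if t < x then exp ((\<mu> - 1) * of_real (ln (x - t))) else 0)"
    by (auto simp: RL_kernel_left fun_eq_iff)
  also have "\<dots> \<in> borel_measurable (borel \<Otimes>\<^sub>M borel)"
    by measurable
  finally show ?thesis .
qed

text \<open>
  The reflection \<open>t \<mapsto> x - t\<close> turns the integral into that of \<open>s powr (Re \<mu> - 1)\<close> over \<open>{0..x}\<close>,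
  where the exponent exceeds \<open>-1\<close>.
\<close>

lemma norm_RL_kernel_integral:
  assumes "0 \<le> x" and "Re \<mu> > 0"
  shows "set_integrable lebesgue {0..x} (\<lambda>t. norm (RL_kernel \<mu> x t))"
    and "(LINT t:{0..x}|lebesgue. norm (RL_kernel \<mu> x t)) = x powr Re \<mu> / Re \<mu>"
proof -
  have "((\<lambda>s. s powr (Re \<mu> - 1)) has_integral x powr Re \<mu> / Re \<mu>) (cbox 0 x)"
    using has_integral_powr_from_0[of "Re \<mu> - 1" x] assms by simp
  from has_integral_affinity[OF this, of "-1" x]
  have "((\<lambda>t. (x - t) powr (Re \<mu> - 1)) has_integral x powr Re \<mu> / Re \<mu>) ((\<lambda>s. x - s) ` {0..x})"
    by simp
  moreover have "(\<lambda>s. x - s) ` {0..x} = {0..x}"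
    by simp
  ultimately have "((\<lambda>t. (x - t) powr (Re \<mu> - 1)) has_integral x powr Re \<mu> / Re \<mu>) {0..x}"
    by simp
  then have int: "((\<lambda>t. norm (RL_kernel \<mu> x t)) has_integral x powr Re \<mu> / Re \<mu>) {0..x}"
    by (rule has_integral_eq[rotated]) (simp add: norm_RL_kernel)
  then show *: "set_integrable lebesgue {0..x} (\<lambda>t. norm (RL_kernel \<mu> x t))"
    by (intro nonnegative_absolutely_integrable_1) auto
  show "(LINT t:{0..x}|lebesgue. norm (RL_kernel \<mu> x t)) = x powr Re \<mu> / Re \<mu>"
    using set_lebesgue_integral_eq_integral(2)[OF *] int by (simp add: integral_unique)
qed

lemma RL_kernel_times_measurable:
  fixes f :: "real \<Rightarrow> complex"
  assumes f: "f \<in> borel_measurable (lebesgue_on {0..d})"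
    and S: "S \<in> sets lebesgue" "S \<subseteq> {0..x}" "S \<subseteq> {0..d}"
  shows "(\<lambda>t. indicator S t *\<^sub>R (RL_kernel \<mu> x t * f t)) \<in> borel_measurable lebesgue"
proof -
  let ?k = "\<lambda>t. if t \<le> x then RL_kernel \<mu> x t else 0"
  let ?F = "\<lambda>t. if t \<in> {0..d} then f t else 0"
  have "?k \<in> borel_measurable borel"
    using measurable_Pair2[OF RL_kernel_left_measurable, of x] by simp
  then have k: "?k \<in> borel_measurable lebesgue"
    by (intro measurable_completion) simp
  have F: "?F \<in> borel_measurable lebesgue"
    using f by (rule borel_measurable_if_I) simp
  have "(\<lambda>t. indicator S t *\<^sub>R (?k t * ?F t)) \<in> borel_measurable lebesgue"
    using S(1) by (intro borel_measurable_scaleR borel_measurable_times k F) simp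
  also have "(\<lambda>t. indicator S t *\<^sub>R (?k t * ?F t)) =
      (\<lambda>t. indicator S t *\<^sub>R (RL_kernel \<mu> x t * f t))"
  proof
    fix t
    show "indicator S t *\<^sub>R (?k t * ?F t) = indicator S t *\<^sub>R (RL_kernel \<mu> x t * f t)"
      using subsetD[OF S(2), of t] subsetD[OF S(3), of t] by (cases "t \<in> S") simp_all
  qed
  finally show ?thesis .
qed

text \<open>
  The function \<open>B * norm (RL_kernel \<mu> x t)\<close> dominates the integrand almost everywhere on
  \<open>{0..x}\<close>; this gives integrability and the estimate together.
\<close>

lemma RL_kernel_integral_bound:
  fixes f :: "real \<Rightarrow> complex"
  assumes x: "0 \<le> x" and \<mu>: "Re \<mu> > 0"
    and f: "f \<in> borel_measurable (lebesgue_on {0..d})"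
    and B: "AE t in lebesgue_on {0..d}. norm (f t) \<le> B" and "0 \<le> B"
    and S: "S \<in> sets lebesgue" "S \<subseteq> {0..x}" "S \<subseteq> {0..d}"
  shows "set_integrable lebesgue S (\<lambda>t. RL_kernel \<mu> x t * f t)"
    and "norm (LINT t:S|lebesgue. RL_kernel \<mu> x t * f t) \<le> B * (x powr Re \<mu> / Re \<mu>)"
proof -
  let ?h = "\<lambda>t. indicator S t *\<^sub>R (RL_kernel \<mu> x t * f t)"
  let ?H = "\<lambda>t. B * (indicator {0..x} t *\<^sub>R norm (RL_kernel \<mu> x t))"
  note K = norm_RL_kernel_integral[OF x \<mu>]
  have H: "integrable lebesgue ?H"
    using K(1) by (simp add: set_integrable_def)
  have h: "?h \<in> borel_measurable lebesgue"
    by (rule RL_kernel_times_measurable[OF f S])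
  have "AE t in lebesgue. t \<in> {0..d} \<longrightarrow> norm (f t) \<le> B"
    using B by (simp add: AE_restrict_space_iff)
  then have le: "AE t in lebesgue. norm (?h t) \<le> ?H t"
  proof eventually_elim
    case (elim t)
    show ?case
    proof (cases "t \<in> S")
      case True
      then have "t \<in> {0..x}" "norm (f t) \<le> B"
        using S elim by auto
      then show ?thesis
        using True by (simp add: norm_mult mult.commute mult_right_mono)
    qed (use \<open>0 \<le> B\<close> in auto)
  qed
  have int: "integrable lebesgue ?h"
    using H h
  proof (rule Bochner_Integration.integrable_bound)
    show "AE t in lebesgue. norm (?h t) \<le> norm (?H t)"
      using le by eventually_elim (metis abs_ge_self order_trans real_norm_def)
  qed
  then show "set_integrable lebesgue S (\<lambda>t. RL_kernel \<mu> x t * f t)"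
    by (simp add: set_integrable_def)
  have "norm (LINT t|lebesgue. ?h t) \<le> (LINT t|lebesgue. norm (?h t))"
    by (rule integral_norm_bound)
  also have "\<dots> \<le> (LINT t|lebesgue. ?H t)"
    by (rule integral_mono_AE[OF integrable_norm[OF int] H le])
  also have "\<dots> = B * (x powr Re \<mu> / Re \<mu>)"
    using K(2) by (simp add: set_lebesgue_integral_def)
  finally show "norm (LINT t:S|lebesgue. RL_kernel \<mu> x t * f t) \<le> B * (x powr Re \<mu> / Re \<mu>)"
    by (simp add: set_lebesgue_integral_def)
qed

section \<open>Integration over a proportional window\<close>

definition RL_window :: "complex \<Rightarrow> real \<Rightarrow> real \<Rightarrow> (real \<Rightarrow> complex) \<Rightarrow> real \<Rightarrow> complex" where
  "RL_window \<mu> a c f x =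
     1 / Gamma \<mu> * (LINT t:{a * x..c * x}|lebesgue. RL_kernel \<mu> x t * f t)"

lemma window_subset:
  fixes a b c x :: real
  assumes "0 \<le> a" "0 \<le> c" "c \<le> 1" "x \<in> {0..b}"
  shows "{a * x..c * x} \<subseteq> {0..x}" and "{a * x..c * x} \<subseteq> {0..c * b}"
proof -
  have "0 \<le> a * x" "c * x \<le> x" "c * x \<le> c * b"
    using assms by (auto simp: mult_left_le_one_le mult_left_mono)
  then show "{a * x..c * x} \<subseteq> {0..x}" "{a * x..c * x} \<subseteq> {0..c * b}"
    by auto
qed

text \<open>
  The equality of the images holds at every \<open>x\<close>, not only almost everywhere.  This allows \<open>f\<close> to be
  replaced by a Borel function in the proof of measurability.
\<close>

lemma RL_window_cong_AE:
  assumes f: "f \<in> borel_measurable (lebesgue_on {0..c * b})"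
    and g: "g \<in> borel_measurable (lebesgue_on {0..c * b})"
    and eq: "AE t in lebesgue_on {0..c * b}. f t = g t"
    and ac: "0 \<le> a" "0 \<le> c" "c \<le> 1" and x: "x \<in> {0..b}"
  shows "RL_window \<mu> a c f x = RL_window \<mu> a c g x"
proof -
  note S = window_subset[OF ac x]
  have meas: "(\<lambda>t. indicator {a * x..c * x} t *\<^sub>R (RL_kernel \<mu> x t * h t)) \<in> borel_measurable lebesgue"
    if "h \<in> borel_measurable (lebesgue_on {0..c * b})" for h :: "real \<Rightarrow> complex"
    by (rule RL_kernel_times_measurable[OF that _ S]) simp
  have "AE t in lebesgue. t \<in> {0..c * b} \<longrightarrow> f t = g t"
    using eq by (simp add: AE_restrict_space_iff)
  then have "AE t in lebesgue. indicator {a * x..c * x} t *\<^sub>R (RL_kernel \<mu> x t * f t) =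
      indicator {a * x..c * x} t *\<^sub>R (RL_kernel \<mu> x t * g t)"
    by eventually_elim (use S in \<open>auto simp: indicator_def\<close>)
  then show ?thesis
    unfolding RL_window_def set_lebesgue_integral_def
    by (subst integral_cong_AE[OF meas[OF f] meas[OF g]]) auto
qed

text \<open>
  A Lebesgue measurable \<open>f\<close> need not make the integrand measurable for the product of the Borel
  algebras, so the theorem on parametrised integrals is applied to a Borel function \<open>g\<close> that agrees
  with \<open>f\<close> almost everywhere.
\<close>

lemma RL_window_measurable:
  assumes f: "f \<in> borel_measurable (lebesgue_on {0..c * b})"
    and ac: "0 \<le> a" "0 \<le> c" "c \<le> 1"
  shows "RL_window \<mu> a c f \<in> borel_measurable (lebesgue_on {0..b})"
proof -
  let ?F = "\<lambda>t. if t \<in> {0..c * b} then f t else 0"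
  have "?F \<in> borel_measurable lebesgue"
    using f by (rule borel_measurable_if_I) simp
  then obtain g where g[measurable]: "g \<in> borel_measurable borel"
    and fg: "AE t in lebesgue. ?F t = g t"
    by (rule lebesgue_measurable_ex_borel)
  have g': "g \<in> borel_measurable (lebesgue_on {0..c * b})"
    by (intro measurable_restrict_space1 measurable_completion) (simp add: g)
  have eq: "AE t in lebesgue_on {0..c * b}. f t = g t"
    using fg by (subst AE_restrict_space_iff) (auto elim!: eventually_mono)
  define K where "K = (\<lambda>x t. (if t \<le> x then RL_kernel \<mu> x t else 0))"
  have [measurable]: "case_prod K \<in> borel_measurable (borel \<Otimes>\<^sub>M borel)"
    using RL_kernel_left_measurable[of \<mu>] by (simp add: K_def)
  have [measurable]: "case_prod K \<in> borel_measurable (borel \<Otimes>\<^sub>M lborel)"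
    by simp
  define I where "I = (\<lambda>x t. (if a * x \<le> t \<and> t \<le> c * x then K x t * g t else 0))"
  have I: "case_prod I \<in> borel_measurable (borel \<Otimes>\<^sub>M lborel)"
    unfolding I_def by measurable
  define J where "J = (\<lambda>x. 1 / Gamma \<mu> * (LINT t|lborel. I x t))"
  have "J \<in> borel_measurable borel"
    unfolding J_def
    by (intro borel_measurable_times borel_measurable_const lborel.borel_measurable_lebesgue_integral I)
  then have "J \<in> borel_measurable (lebesgue_on {0..b})"
    by (intro measurable_restrict_space1 measurable_completion) simp
  moreover have "RL_window \<mu> a c f x = J x" if x: "x \<in> {0..b}" for x
  proof -
    have "(\<lambda>t. indicator {a * x..c * x} t *\<^sub>R (RL_kernel \<mu> x t * g t)) = I x"
      using window_subset(1)[OF ac x] by (force simp: I_def K_def indicator_def)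
    moreover have "I x \<in> borel_measurable lborel"
      using measurable_Pair2[OF I, of x] by simp
    ultimately have "RL_window \<mu> a c g x = J x"
      by (simp add: RL_window_def J_def set_lebesgue_integral_def integral_completion)
    with RL_window_cong_AE[OF f g' eq ac x] show ?thesis
      by simp
  qed
  ultimately show ?thesis
    by (subst measurable_cong[where g = J]) auto
qed

lemma RL_window_integrable_bounded:
  assumes f: "f \<in> Linf (lebesgue_on {0..c * b})" and "0 < b" "Re \<mu> > 0"
    and ac: "0 \<le> a" "0 < c" "c \<le> 1" and x: "x \<in> {0..b}"
  shows "set_integrable lebesgue {a * x..c * x} (\<lambda>t. RL_kernel \<mu> x t * f t)"
    and "norm (RL_window \<mu> a c f x) \<le>
      norm (1 / Gamma \<mu>) * (b powr Re \<mu> / Re \<mu>) * Linf_norm (lebesgue_on {0..c * b}) f"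
proof -
  let ?B = "Linf_norm (lebesgue_on {0..c * b}) f"
  have "0 < c * b"
    using assms by simp
  note B = Linf_AE_bound[OF f emeasure_lebesgue_on_interval_nonzero[OF this]]
  have f': "f \<in> borel_measurable (lebesgue_on {0..c * b})"
    using f by (simp add: Linf_def)
  have "0 \<le> x" and xb: "x powr Re \<mu> \<le> b powr Re \<mu>"
    using x \<open>Re \<mu> > 0\<close> by (auto intro: powr_mono2)
  note * = RL_kernel_integral_bound[OF \<open>0 \<le> x\<close> \<open>Re \<mu> > 0\<close> f' B(2,1) _
      window_subset[OF ac(1) less_imp_le[OF ac(2)] ac(3) x]]
  show "set_integrable lebesgue {a * x..c * x} (\<lambda>t. RL_kernel \<mu> x t * f t)"
    by (rule *(1)) simp
  have "norm (LINT t:{a * x..c * x}|lebesgue. RL_kernel \<mu> x t * f t) \<le> ?B * (x powr Re \<mu> / Re \<mu>)"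
    by (rule *(2)) simp
  also have "\<dots> \<le> ?B * (b powr Re \<mu> / Re \<mu>)"
    using xb \<open>Re \<mu> > 0\<close> B(1) by (intro mult_left_mono divide_right_mono) auto
  finally have "norm (1 / Gamma \<mu>) * norm (LINT t:{a * x..c * x}|lebesgue. RL_kernel \<mu> x t * f t)
      \<le> norm (1 / Gamma \<mu>) * (?B * (b powr Re \<mu> / Re \<mu>))"
    by (rule mult_left_mono) simp
  then show "norm (RL_window \<mu> a c f x) \<le> norm (1 / Gamma \<mu>) * (b powr Re \<mu> / Re \<mu>) * ?B"
    unfolding RL_window_def norm_mult by (simp only: mult_ac)
qed

lemma RL_window_bounded_operator:
  assumes b: "0 < b" and \<mu>: "Re \<mu> > 0" and ac: "0 \<le> a" "0 < c" "c \<le> 1"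
  shows "Linf_bounded_operator (lebesgue_on {0..c * b}) (lebesgue_on {0..b}) (RL_window \<mu> a c)"
    (is "Linf_bounded_operator ?M ?N ?T")
proof -
  define C where "C = norm (1 / Gamma \<mu>) * (b powr Re \<mu> / Re \<mu>)"
  have "0 \<le> C"
    using \<mu> by (simp add: C_def)
  have c: "0 \<le> c"
    using ac by simp
  have meas: "f \<in> borel_measurable ?M" if "f \<in> Linf ?M" for f
    using that by (simp add: Linf_def)
  have everywhere: "AE x in ?N. P x" if "\<And>x. x \<in> {0..b} \<Longrightarrow> P x" for P
    using that by (intro AE_I2) auto
  note int = RL_window_integrable_bounded(1)[OF _ b \<mu> ac]
  have bound: "AE x in ?N. norm (?T f x) \<le> C * Linf_norm ?M f" if "f \<in> Linf ?M" for f
    unfolding C_def by (intro everywhere RL_window_integrable_bounded(2)[OF that b \<mu> ac])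
  note Linf = Linf_I[OF RL_window_measurable[OF meas ac(1) c ac(3)] bound
      emeasure_lebesgue_on_interval_nonzero[OF b]]
  show ?thesis
    unfolding Linf_bounded_operator_def
  proof (intro conjI ballI allI impI)
    fix f assume f: "f \<in> Linf ?M"
    show "?T f \<in> Linf ?N"
      by (rule Linf(1)[OF f f])
    fix g assume g: "g \<in> Linf ?M"
    show "AE x in ?N. ?T f x = ?T g x" if "AE x in ?M. f x = g x"
      by (intro everywhere RL_window_cong_AE[OF meas[OF f] meas[OF g] that ac(1) c ac(3)])
    show "AE x in ?N. ?T (\<lambda>t. f t + g t) x = ?T f x + ?T g x"
      by (intro everywhere)
        (simp add: RL_window_def distrib_left set_integral_add(2)[OF int[OF f] int[OF g]])
  next
    fix k f assume "f \<in> Linf ?M"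
    show "AE x in ?N. ?T (\<lambda>t. k * f t) x = k * ?T f x"
      by (intro everywhere) (simp add: RL_window_def mult.left_commute)
  next
    show "\<exists>C\<ge>0. \<forall>f\<in>Linf ?M. Linf_norm ?N (?T f) \<le> C * Linf_norm ?M f"
      using \<open>0 \<le> C\<close> Linf(2) by blast
  qed
qed

lemma RL_lower_eq_window: "RL_lower \<mu> y = RL_window \<mu> 0 y"
  and RL_upper_eq_window: "RL_upper \<mu> y = RL_window \<mu> y 1"
  by (simp_all add: fun_eq_iff RL_lower_def RL_upper_def RL_window_def)

theorem theorem2p3:
  fixes b y :: real and \<mu> :: complex
  assumes "b > 0" and "0 < y" and "y < 1" and "Re \<mu> > 0"
  shows
    "((\<forall>f\<in>Linf (lebesgue_on {0..y * b}). \<forall>x\<in>{0..b}.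
         set_integrable lebesgue {0..y * x} (\<lambda>t. RL_kernel \<mu> x t * f t)) \<and>
      Linf_bounded_operator (lebesgue_on {0..y * b}) (lebesgue_on {0..b}) (RL_lower \<mu> y)) \<and>
     ((\<forall>f\<in>Linf (lebesgue_on {0..b}). \<forall>x\<in>{0..b}.
         set_integrable lebesgue {y * x..x} (\<lambda>t. RL_kernel \<mu> x t * f t)) \<and>
      Linf_bounded_operator (lebesgue_on {0..b}) (lebesgue_on {0..b}) (RL_upper \<mu> y))"
proof -
  have lower: "set_integrable lebesgue {0..y * x} (\<lambda>t. RL_kernel \<mu> x t * f t)"
    if "f \<in> Linf (lebesgue_on {0..y * b})" "x \<in> {0..b}" for f x
    using RL_window_integrable_bounded(1)[of f y b \<mu> 0 x] that assms by simp
  have upper: "set_integrable lebesgue {y * x..x} (\<lambda>t. RL_kernel \<mu> x t * f t)"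
    if "f \<in> Linf (lebesgue_on {0..b})" "x \<in> {0..b}" for f x
    using RL_window_integrable_bounded(1)[of f 1 b \<mu> y x] that assms by simp
  show ?thesis
    using lower upper RL_window_bounded_operator[of b \<mu> 0 y]
      RL_window_bounded_operator[of b \<mu> y 1] assms
    by (simp add: RL_lower_eq_window RL_upper_eq_window)
qed

end
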